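(* Let $s$ be the unique real solution of the initial value problem $\ddot{s}(t) = 6t - 6 s(t)^2$, $s(0) = \dot{s}(0) = 0$. Let $0 < a < b$. If $s(t) < \sqrt{t}$ for all $t$ in the interval $(a, b)$, then $$b - a < \pi \, 6^{-1/2} \, a^{-1/4}.$$
   Context: Dots denote derivatives with respect to the real variable $t$. The solution $s$ is taken on its maximal real interval of existence, which contains $[0, \infty)$; it is considered only for nonnegative arguments. *)

theory Defs
  imports Complex_Main
begin

text \<open>
  The function \<open>s\<close> is a real solution, on the half-line of nonnegative arguments, of
  the initial value problem \<open>s'' = 6 t - 6 s\<^sup>2\<close>, \<open>s(0) = s'(0) = 0\<close>. The witness
  \<open>v\<close> is the derivative of \<open>s\<close>; at \<open>t = 0\<close> both derivatives are
  one-sided, at \<open>t > 0\<close> they are the ordinary two-sided ones. The values of \<open>s\<close> at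
  negative arguments are irrelevant.
\<close>

definition ivp_solution :: "(real \<Rightarrow> real) \<Rightarrow> bool" where
  "ivp_solution s \<longleftrightarrow>
     (\<exists>v :: real \<Rightarrow> real.
        (\<forall>t\<ge>0. (s has_real_derivative v t) (at t within {0..})) \<and>
        (\<forall>t\<ge>0. (v has_real_derivative (6 * t - 6 * (s t)\<^sup>2)) (at t within {0..})) \<and>
        s 0 = 0 \<and> v 0 = 0)"

end

theory Submission
  imports Defs "HOL-Analysis.Analysis"
begin

text \<open>
  The energy \<open>E = s'\<^sup>2 / 2 + 2 s\<^sup>3 - 6 t s\<close> satisfies \<open>E' = - 6 s\<close> and \<open>E 0 = 0\<close>. Since \<open>s > 0\<close> for
  small \<open>t > 0\<close>, at a first positive zero of \<open>s\<close> the energy would be negative, yet it equals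
  \<open>s'\<^sup>2 / 2\<close> there; hence \<open>s > 0\<close> for all \<open>t > 0\<close>. Now \<open>w = sqrt t - s\<close> satisfies
  \<open>w'' = - 6 (sqrt t + s) w - t powr (-3/2) / 4 < - 6 sqrt a w\<close> wherever \<open>t > a\<close> and \<open>w > 0\<close>, and
  Sturm comparison with \<open>sin (\<omega> (t - a))\<close>, \<open>\<omega>\<^sup>2 = 6 sqrt a\<close>, bounds the length of such an interval
  by \<open>pi / \<omega>\<close>.
\<close>

text \<open>If the interval had length at least \<open>pi / \<omega>\<close>, one full arch of the
  sine would fit into it. The Wronskian of \<open>w\<close> with that arch would strictly decrease
  along it, yet its end values have signs that force the opposite.\<close>

lemma sturm_comparison_less:
  fixes w w' w'' :: "real \<Rightarrow> real"
  assumes "\<omega> > 0" "a < b"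
    and cw: "continuous_on {a..b} w" and cw': "continuous_on {a..b} w'"
    and dw: "\<And>t. t \<in> {a<..<b} \<Longrightarrow> (w has_real_derivative w' t) (at t)"
    and dw': "\<And>t. t \<in> {a<..<b} \<Longrightarrow> (w' has_real_derivative w'' t) (at t)"
    and pos: "\<And>t. t \<in> {a<..<b} \<Longrightarrow> w t > 0"
    and less: "\<And>t. t \<in> {a<..<b} \<Longrightarrow> w'' t < - (\<omega>\<^sup>2 * w t)"
  shows "b - a < pi / \<omega>"
proof (rule ccontr)
  assume "\<not> b - a < pi / \<omega>"
  define c where "c = a + pi / \<omega>"
  have ac: "a < c" and cb: "c \<le> b"
    using \<open>\<omega> > 0\<close> \<open>\<not> b - a < pi / \<omega>\<close> by (auto simp: c_def)
  \<comment> \<open>Positivity is assumed only inside the interval; at the endpoints, and so at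
    \<open>c\<close> when \<open>c = b\<close>, continuity leaves just this weak bound.\<close>
  have nonneg: "w t \<ge> 0" if "t \<in> {a..b}" for t
    using continuous_ge_on_closure[of "{a<..<b}" w t 0] cw pos that \<open>a < b\<close>
    by (auto simp: less_imp_le)
  \<comment> \<open>The Wronskian: the terms with \<open>w'\<close> and the cosine cancel in its
    derivative, and at \<open>a\<close> and \<open>c\<close>, where the sine vanishes, only the
    cosine term is left.\<close>
  define W where "W t = w' t * sin (\<omega> * (t - a)) - \<omega> * w t * cos (\<omega> * (t - a))" for t
  have "W c < W a"
  proof (rule DERIV_neg_imp_decreasing_open[OF ac])
    fix t assume t: "a < t" "t < c"
    then have tI: "t \<in> {a<..<b}" using cb by auto
    have "\<omega> * (t - a) < pi"
      using t \<open>\<omega> > 0\<close> by (simp add: c_def field_simps)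
    then have "sin (\<omega> * (t - a)) > 0"
      using t \<open>\<omega> > 0\<close> by (intro sin_gt_zero) auto
    moreover have "(W has_real_derivative (w'' t + \<omega>\<^sup>2 * w t) * sin (\<omega> * (t - a))) (at t)"
      unfolding W_def using dw[OF tI] dw'[OF tI]
      by (auto intro!: derivative_eq_intros simp: algebra_simps power2_eq_square)
    ultimately show "\<exists>y. (W has_real_derivative y) (at t) \<and> y < 0"
      using less[OF tI] by (intro exI conjI) (auto intro: mult_neg_pos)
  next
    show "continuous_on {a..c} W"
      unfolding W_def using cb
      by (intro continuous_intros continuous_on_subset[OF cw] continuous_on_subset[OF cw']) auto
  qed
  moreover have "\<omega> * (c - a) = pi"
    using \<open>\<omega> > 0\<close> by (simp add: c_def)
  then have "W c = \<omega> * w c" by (simp add: W_def)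
  moreover have "W a = - (\<omega> * w a)" by (simp add: W_def)
  moreover have "0 \<le> \<omega> * w a" "0 \<le> \<omega> * w c"
    using nonneg \<open>\<omega> > 0\<close> ac cb by simp_all
  ultimately show False by linarith
qed

context
  fixes s v :: "real \<Rightarrow> real"
  assumes ds: "\<And>t. t \<ge> 0 \<Longrightarrow> (s has_real_derivative v t) (at t within {0..})"
    and dv: "\<And>t. t \<ge> 0 \<Longrightarrow> (v has_real_derivative (6 * t - 6 * (s t)\<^sup>2)) (at t within {0..})"
    and s0: "s 0 = 0" and v0: "v 0 = 0"
begin

lemma ivp_deriv:
  assumes "t > 0"
  shows "(s has_real_derivative v t) (at t)"
    and "(v has_real_derivative (6 * t - 6 * (s t)\<^sup>2)) (at t)"
  using ds[of t] dv[of t] assms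
  by (auto simp: at_within_interior[of t "{0..}"])

lemma ivp_continuous_on:
  assumes "A \<subseteq> {0..}"
  shows "continuous_on A s" "continuous_on A v"
  by (rule DERIV_continuous_on, rule has_field_derivative_subset[OF _ assms], rule ds dv,
      use assms in auto)+

text \<open>The zero slope at 0 gives \<open>\<bar>s t\<bar> < t\<close> for small
  \<open>t > 0\<close>. If also \<open>t < 1\<close>, then
  \<open>(s t)\<^sup>2 < t\<^sup>2 < t\<close>, so \<open>v\<close> has positive derivative; hence
  first \<open>v\<close> and then \<open>s\<close> increases from 0.\<close>

lemma ivp_initially_pos: "\<exists>d>0. \<forall>t\<in>{0<..d}. s t > 0"
proof -
  have "((\<lambda>t. (s t - s 0) / (t - 0)) \<longlongrightarrow> 0) (at 0 within {0..})"
    using ds[of 0] v0 by (simp add: has_field_derivative_iff)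
  then have "eventually (\<lambda>t. \<bar>s t / t\<bar> < 1) (at 0 within {0..})"
    using tendstoD[of _ 0 _ 1] by (fastforce simp: s0 dist_real_def)
  then obtain e where e: "e > 0" "\<And>t. t > 0 \<Longrightarrow> t < e \<Longrightarrow> \<bar>s t / t\<bar> < 1"
    by (auto simp: eventually_at dist_real_def)
  define d where "d = min (e / 2) (1 / 2)"
  have d: "d > 0" "d < e" "d < 1" using e(1) by (auto simp: d_def)
  have v_pos: "v t > 0" if t: "0 < t" "t \<le> d" for t
  proof -
    have "v 0 < v t"
    proof (rule DERIV_pos_imp_increasing_open[OF t(1)])
      fix x assume x: "0 < x" "x < t"
      have "\<bar>s x\<bar> < x" using e(2)[of x] x t d by (simp add: field_simps)
      then have "(s x)\<^sup>2 < x\<^sup>2" using x by (simp add: abs_square_less_1 power2_strict_mono)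
      also have "x\<^sup>2 < x" using x t d by (simp add: power2_eq_square)
      finally show "\<exists>y. (v has_real_derivative y) (at x) \<and> y > 0"
        using ivp_deriv(2)[OF x(1)] by (intro exI conjI) (assumption, simp)
    qed (rule ivp_continuous_on, auto)
    then show ?thesis by (simp add: v0)
  qed
  have "s t > 0" if t: "0 < t" "t \<le> d" for t
  proof -
    have "s 0 < s t"
    proof (rule DERIV_pos_imp_increasing_open[OF t(1)])
      fix x assume "0 < x" "x < t"
      then show "\<exists>y. (s has_real_derivative y) (at x) \<and> y > 0"
        using ivp_deriv(1)[of x] v_pos[of x] t by auto
    qed (rule ivp_continuous_on, auto)
    then show ?thesis by (simp add: s0)
  qed
  then show ?thesis using d by auto
qed

lemma ivp_pos:
  assumes "t > 0"
  shows "s t > 0"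
proof (rule ccontr)
  assume "\<not> s t > 0"
  obtain d where d: "d > 0" "\<And>x. 0 < x \<Longrightarrow> x \<le> d \<Longrightarrow> s x > 0"
    using ivp_initially_pos by auto
  have "d < t" using d \<open>\<not> s t > 0\<close> assms by force
  \<comment> \<open>Starting at \<open>d\<close> keeps the zero of \<open>s\<close> at 0 out of
    \<open>Z\<close>, so the infimum is the first positive zero.\<close>
  define Z where "Z = {d..t} \<inter> s -` {..0}"
  have "closed Z"
    unfolding Z_def using d by (intro continuous_closed_preimage ivp_continuous_on) auto
  moreover have Z: "t \<in> Z" "bdd_below Z"
    using \<open>d < t\<close> \<open>\<not> s t > 0\<close> by (auto simp: Z_def)
  ultimately have "Inf Z \<in> Z" using closed_contains_Inf by blast
  define z where "z = Inf Z"
  have z: "d < z" "z \<le> t" "s z \<le> 0"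
    using \<open>Inf Z \<in> Z\<close> d(1) d(2)[of d] by (auto simp: Z_def z_def order.order_iff_strict)
  have pos: "s x > 0" if "0 < x" "x < z" for x
  proof (cases "x \<le> d")
    case False
    have "x \<notin> Z" using cInf_lower[of x Z] Z(2) that by (auto simp: z_def)
    then show ?thesis using False that z by (auto simp: Z_def)
  qed (use that d in auto)
  have "s z \<ge> 0"
    using continuous_ge_on_closure[of "{0<..<z}" s z 0] ivp_continuous_on(1)[of "{0..z}"] pos z d
    by (auto simp: less_imp_le)
  with z have "s z = 0" by simp
  define E where "E x = (v x)\<^sup>2 / 2 + 2 * s x ^ 3 - 6 * x * s x" for x
  have "0 < z" using d z by simp
  have "E z < E 0"
  proof (rule DERIV_neg_imp_decreasing_open[OF \<open>0 < z\<close>])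
    fix x assume x: "0 < x" "x < z"
    \<comment> \<open>By the differential equation all terms containing \<open>v\<close> cancel;
      what remains comes from the explicit factor \<open>x\<close> in \<open>E\<close>.\<close>
    have "(E has_real_derivative - 6 * s x) (at x)"
      unfolding E_def using ivp_deriv[of x] x
      by (auto intro!: derivative_eq_intros simp: field_simps power2_eq_square)
    then show "\<exists>y. (E has_real_derivative y) (at x) \<and> y < 0"
      using pos[OF x] by (intro exI conjI) auto
  next
    show "continuous_on {0..z} E"
      unfolding E_def by (intro continuous_intros ivp_continuous_on) auto
  qed
  then show False by (simp add: E_def \<open>s z = 0\<close> s0 v0)
qed

lemma ivp_interval_below_sqrt:
  assumes "0 < a" "a < b" and below: "\<And>t. t \<in> {a<..<b} \<Longrightarrow> s t < sqrt t"
  shows "b - a < pi / sqrt (6 * sqrt a)"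
proof (rule sturm_comparison_less)
  let ?w'' = "\<lambda>t. - (inverse (sqrt t) ^ 3 / 4) - (6 * t - 6 * (s t)\<^sup>2)"
  show "sqrt (6 * sqrt a) > 0" using assms by simp
  show "continuous_on {a..b} (\<lambda>t. sqrt t - s t)"
    "continuous_on {a..b} (\<lambda>t. inverse (sqrt t) / 2 - v t)"
    using assms by (auto intro!: continuous_intros ivp_continuous_on)
  fix t assume t: "t \<in> {a<..<b}"
  then have "t > 0" using assms by auto
  show "((\<lambda>t. sqrt t - s t) has_real_derivative inverse (sqrt t) / 2 - v t) (at t)"
    using ivp_deriv(1) \<open>t > 0\<close> by (auto intro!: derivative_eq_intros)
  show "((\<lambda>t. inverse (sqrt t) / 2 - v t) has_real_derivative ?w'' t) (at t)"
    using ivp_deriv(2) \<open>t > 0\<close>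
    by (auto intro!: derivative_eq_intros simp: power3_eq_cube field_simps)
  show "sqrt t - s t > 0" using below[OF t] by simp
  have "s t > 0" by (rule ivp_pos) fact
  \<comment> \<open>Positivity of \<open>s\<close> enters here: it gives
    \<open>sqrt t + s t \<ge> sqrt a\<close>.\<close>
  have "sqrt a * (sqrt t - s t) \<le> (sqrt t + s t) * (sqrt t - s t)"
    using below[OF t] \<open>s t > 0\<close> t by (intro mult_right_mono) (auto intro: add_increasing2)
  also have "\<dots> = t - (s t)\<^sup>2"
    using \<open>t > 0\<close> by (simp add: algebra_simps power2_eq_square)
  finally have "6 * sqrt a * (sqrt t - s t) \<le> 6 * t - 6 * (s t)\<^sup>2" by simp
  \<comment> \<open>The concavity of the square root makes the comparison strict.\<close>
  moreover have "inverse (sqrt t) ^ 3 > 0" using \<open>t > 0\<close> by simp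
  moreover have "(sqrt (6 * sqrt a))\<^sup>2 = 6 * sqrt a" using \<open>0 < a\<close> by simp
  ultimately show "?w'' t < - ((sqrt (6 * sqrt a))\<^sup>2 * (sqrt t - s t))"
    by (simp only:)
qed fact

end

theorem theorem8:
  fixes s :: "real \<Rightarrow> real" and a b :: real
  assumes "ivp_solution s"
    and "0 < a" and "a < b"
    and "\<forall>t\<in>{a<..<b}. s t < sqrt t"
  shows "b - a < pi * 6 powr (-1/2) * a powr (-1/4)"
proof -
  obtain v where "\<And>t. t \<ge> 0 \<Longrightarrow> (s has_real_derivative v t) (at t within {0..})"
    and "\<And>t. t \<ge> 0 \<Longrightarrow> (v has_real_derivative (6 * t - 6 * (s t)\<^sup>2)) (at t within {0..})"
    and "s 0 = 0" "v 0 = 0"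
    using assms(1) unfolding ivp_solution_def by blast
  then have "b - a < pi / sqrt (6 * sqrt a)"
    by (rule ivp_interval_below_sqrt) (use assms in auto)
  also have "sqrt (6 * sqrt a) = 6 powr (1/2) * a powr (1/4)"
    using \<open>0 < a\<close> by (simp add: powr_half_sqrt[symmetric] powr_mult powr_powr)
  also have "pi / \<dots> = pi * 6 powr (-1/2) * a powr (-1/4)"
    unfolding minus_divide_left[symmetric] powr_minus by (simp add: field_simps)
  finally show ?thesis .
qed

end
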